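(* Let $n\ge1$, let $\mu$ be the uniform probability measure on $\{-1,1\}^n$, let $0<\rho<1$, and let $f:\{-1,1\}^n\to[0,\infty)$ satisfy $\mathbb{E}_\mu f=1$. Then for every $\eta>1$, $$\mu\bigl(T_\rho f>\eta\bigr)\le \sqrt{\frac{1+\rho}{1-\rho}}\;\frac{1}{\eta\sqrt{\log\eta}}.$$
   Context: $T_\rho$ is the noise operator on the cube: for $x\in\{-1,1\}^n$, $$T_\rho f(x)=2^{-n}\sum_{z\in\{-1,1\}^n} f(z)\prod_{i=1}^n(1+\rho x_iz_i).$$ *)

theory Defs
  imports "HOL-Probability.Probability"
begin

text \<open>
  Points of the cube are functions on the index set \<open>{1..n}\<close>, extensional (that is,
  \<open>undefined\<close>) outside it, so that the cube has exactly \<open>2 ^ n\<close> elements.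
\<close>

definition cube :: "nat \<Rightarrow> (nat \<Rightarrow> real) set" where
  "cube n = {1..n} \<rightarrow>\<^sub>E {-1, 1}"

definition cube_pmf :: "nat \<Rightarrow> (nat \<Rightarrow> real) pmf" where
  "cube_pmf n = pmf_of_set (cube n)"

definition noise_op ::
    "nat \<Rightarrow> real \<Rightarrow> ((nat \<Rightarrow> real) \<Rightarrow> real) \<Rightarrow> (nat \<Rightarrow> real) \<Rightarrow> real" where
  "noise_op n \<rho> f x =
     1 / 2 ^ n * (\<Sum>z\<in>cube n. f z * (\<Prod>i=1..n. 1 + \<rho> * x i * z i))"

text \<open>
  \<open>pmf_of_set\<close> is unspecified on empty and infinite sets; neither occurs here.
\<close>

lemma finite_cube: "finite (cube n)"
  unfolding cube_def by (intro finite_PiE) auto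

lemma cube_nonempty: "cube n \<noteq> {}"
  unfolding cube_def by (simp add: PiE_eq_empty_iff)

lemma card_cube: "card (cube n) = 2 ^ n"
  unfolding cube_def by (subst card_PiE) (simp_all add: numeral_2_eq_2)

end

theory Submission
  imports Defs
begin

text \<open>
  Let \<open>g = T\<^sub>\<rho> f\<close>, \<open>A = {g > \<eta>}\<close>, and let \<open>Q\<close> be the joint law of \<open>z \<sim> f\<mu>\<close> and its noisy copy \<open>x\<close>, so that
  \<open>x\<close> has density \<open>g\<close>. Reveal \<open>x\<close> one coordinate at a time, and let \<open>u\<^sub>k\<close> be the conditional mean of \<open>x\<^sub>k\<close>
  under \<open>Q\<close> given the earlier coordinates, set to \<open>0\<close> once the martingale \<open>E\<^sub>\<mu>[g | x\<^sub>1, \<dots>, x\<^sub>k]\<close> has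
  exceeded \<open>\<eta>\<close>. Then \<open>\<Sum> u\<^sub>k x\<^sub>k \<ge> ln \<eta>\<close> on \<open>A\<close>, since \<open>t \<ge> ln (1 + t)\<close>, and \<open>E\<^sub>Q \<Sum> u\<^sub>k\<^sup>2 \<le> 2 ln (2\<eta>)\<close>,
  since the entropy of a sign with mean \<open>u\<close> relative to a fair one is at least \<open>u\<^sup>2 / 2\<close>.

  Given \<open>z\<close>, the sum \<open>N = \<Sum> u\<^sub>k (1 + \<rho> sgn(u\<^sub>k) z\<^sub>k) (x\<^sub>k - \<rho> z\<^sub>k)\<close> is a martingale, so that
  \<open>E\<^sub>Q N\<^sup>2 \<le> (1 - \<rho>\<^sup>2) (1 + \<rho>)\<^sup>2 E\<^sub>Q \<Sum> u\<^sub>k\<^sup>2\<close>. In \<open>E\<^sub>Q[1\<^sub>A N]\<close> only the edges of the cube that leave \<open>A\<close>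
  survive, and comparing \<open>g\<close> with \<open>\<eta>\<close> there gives
  \<open>(1 - \<rho>\<^sup>2) \<eta> E\<^sub>\<mu>[1\<^sub>A \<Sum> u\<^sub>k x\<^sub>k] \<le> E\<^sub>Q[1\<^sub>A N] = E\<^sub>Q[(1\<^sub>A - 1/2) N] \<le> (E\<^sub>Q N\<^sup>2)\<^sup>1\<^sup>/\<^sup>2 / 2\<close>. This is the claim if
  \<open>ln \<eta> \<ge> ln 2\<close>, and for \<open>ln \<eta> \<le> 1\<close> Markov's inequality suffices.
\<close>

section \<open>Points of the cube and averaging over one coordinate\<close>

lemma cube_fun_upd:
  assumes "x \<in> cube n" "k \<in> {1..n}" "e \<in> {-1, 1}"
  shows "x(k := e) \<in> cube n"
  using assms unfolding cube_def by (auto simp: PiE_iff extensional_def)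

lemma cube_cases: "x \<in> cube n \<Longrightarrow> k \<in> {1..n} \<Longrightarrow> x k = 1 \<or> x k = - 1"
  using PiE_mem[of x "{1..n}" "\<lambda>_. {-1, 1}" k] by (auto simp: cube_def)

lemma cube_sq: "x \<in> cube n \<Longrightarrow> k \<in> {1..n} \<Longrightarrow> x k * x k = 1"
  using cube_cases[of x n k] by auto

text \<open>Flipping coordinate \<open>k\<close> is an involution of the cube, so \<open>h\<close>
  may be averaged with its flip. This acts as conditioning on all coordinates but \<open>k\<close>
  and drives the inductions over coordinates below.\<close>

lemma sum_cube_coordinate:
  fixes h :: "(nat \<Rightarrow> real) \<Rightarrow> real"
  assumes k: "k \<in> {1..n}"
  shows "(\<Sum>x\<in>cube n. h x) = (\<Sum>x\<in>cube n. (h (x(k := 1)) + h (x(k := - 1))) / 2)"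
proof -
  have flip: "(\<Sum>x\<in>cube n. h (x(k := - x k))) = (\<Sum>x\<in>cube n. h x)"
    by (rule sum.reindex_bij_witness[where i = "\<lambda>x. x(k := - x k)" and j = "\<lambda>x. x(k := - x k)"])
      (use k in \<open>auto intro!: cube_fun_upd dest: cube_cases\<close>)
  have "h x + h (x(k := - x k)) = h (x(k := 1)) + h (x(k := - 1))" if "x \<in> cube n" for x
    using cube_cases[OF that k] by (auto simp: fun_upd_idem_iff fun_upd_idem)
  then have "(\<Sum>x\<in>cube n. (h (x(k := 1)) + h (x(k := - 1))) / 2)
      = (\<Sum>x\<in>cube n. (h x + h (x(k := - x k))) / 2)"
    by (intro sum.cong) auto
  also have "\<dots> = (\<Sum>x\<in>cube n. h x)"
    by (simp add: sum_divide_distrib[symmetric] sum.distrib flip)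
  finally show ?thesis by simp
qed

section \<open>The noise kernel and its martingales\<close>

text \<open>For \<open>z\<close> in the cube and \<open>m \<le> n\<close>, this is the density in
  \<open>x\<close>, relative to the uniform measure, of a point whose first \<open>m\<close>
  coordinates are a noisy copy of those of \<open>z\<close> and whose other coordinates are fair
  signs.\<close>

definition noise_weight :: "real \<Rightarrow> nat \<Rightarrow> (nat \<Rightarrow> real) \<Rightarrow> (nat \<Rightarrow> real) \<Rightarrow> real" where
  "noise_weight \<rho> m x z = (\<Prod>i=1..m. 1 + \<rho> * x i * z i)"

lemma noise_weight_0 [simp]: "noise_weight \<rho> 0 x z = 1"
  by (simp add: noise_weight_def)

lemma noise_weight_Suc:
  "noise_weight \<rho> (Suc m) x z = noise_weight \<rho> m x z * (1 + \<rho> * x (Suc m) * z (Suc m))"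
  by (simp add: noise_weight_def)

lemma noise_weight_upd_above:
  "m < k \<Longrightarrow> noise_weight \<rho> m (x(k := e)) z = noise_weight \<rho> m x z"
  unfolding noise_weight_def by (intro prod.cong) auto

lemma noise_weight_remove:
  assumes "k \<in> {1..m}"
  shows "noise_weight \<rho> m x z = (1 + \<rho> * x k * z k) * (\<Prod>i\<in>{1..m} - {k}. 1 + \<rho> * x i * z i)"
  unfolding noise_weight_def using assms by (subst prod.remove[of _ k]) auto

lemma noise_factor_bounds:
  assumes "0 < \<rho>" "\<rho> < 1" "x \<in> cube n" "z \<in> cube n" "i \<in> {1..n}"
  shows "0 < 1 + \<rho> * x i * z i" "1 + \<rho> * x i * z i \<le> (2::real)"
  using assms(1,2) cube_cases[OF assms(3,5)] cube_cases[OF assms(4,5)] by auto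

lemma noise_weight_pos:
  assumes "0 < \<rho>" "\<rho> < 1" "x \<in> cube n" "z \<in> cube n" "m \<le> n"
  shows "0 < noise_weight \<rho> m x z"
  unfolding noise_weight_def
proof (rule prod_pos)
  fix i assume "i \<in> {1..m}"
  then show "0 < 1 + \<rho> * x i * z i"
    using assms(5) by (intro noise_factor_bounds(1)[OF assms(1-4)]) auto
qed

text \<open>The assumption on \<open>c\<close> is predictability. Given the earlier coordinates,
  \<open>x k - \<rho> * z k\<close> has mean 0 and variance \<open>1 - \<rho>\<^sup>2\<close> under
  the kernel, so the increments of \<open>S\<close> are centred and orthogonal. Each induction step
  averages over the last coordinate.\<close>

lemma sum_noise_weight_martingale:
  fixes \<rho> :: real and c :: "nat \<Rightarrow> (nat \<Rightarrow> real) \<Rightarrow> real"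
  assumes z: "z \<in> cube n" and "m \<le> n"
    and c: "\<And>j k x e. j \<le> k \<Longrightarrow> c j (x(k := e)) = c j x"
  defines "S \<equiv> \<lambda>m x. \<Sum>k=1..m. c k x * (x k - \<rho> * z k)"
  shows "(\<Sum>x\<in>cube n. noise_weight \<rho> m x z * S m x) = 0"
    and "(\<Sum>x\<in>cube n. noise_weight \<rho> m x z * (S m x)\<^sup>2)
       = (1 - \<rho>\<^sup>2) * (\<Sum>x\<in>cube n. noise_weight \<rho> m x z * (\<Sum>k=1..m. (c k x)\<^sup>2))"
    and "(\<Sum>x\<in>cube n. noise_weight \<rho> m x z) = 2 ^ n"
proof -
  have "(\<Sum>x\<in>cube n. noise_weight \<rho> m x z * S m x) = 0 \<and>
     (\<Sum>x\<in>cube n. noise_weight \<rho> m x z * (S m x)\<^sup>2)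
       = (\<Sum>x\<in>cube n. noise_weight \<rho> m x z * ((1 - \<rho>\<^sup>2) * (\<Sum>k=1..m. (c k x)\<^sup>2))) \<and>
     (\<Sum>x\<in>cube n. noise_weight \<rho> m x z) = 2 ^ n"
    using \<open>m \<le> n\<close>
  proof (induction m)
    case 0
    then show ?case by (simp add: S_def card_cube)
  next
    case (Suc m)
    let ?k = "Suc m"
    have k: "?k \<in> {1..n}" using Suc.prems by simp
    have z2: "z ?k * z ?k = 1" using cube_sq[OF z k] .
    have w: "noise_weight \<rho> ?k (x(?k := e)) z = noise_weight \<rho> m x z * (1 + \<rho> * e * z ?k)" for x e
      by (simp add: noise_weight_Suc noise_weight_upd_above)
    have Sm: "S m (x(?k := e)) = S m x" for x e
      unfolding S_def by (intro sum.cong) (auto simp: c)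
    have S: "S ?k (x(?k := e)) = S m x + c ?k x * (e - \<rho> * z ?k)" for x e
    proof -
      have "S ?k (x(?k := e)) = S m (x(?k := e)) + c ?k (x(?k := e)) * (e - \<rho> * z ?k)"
        by (simp add: S_def)
      then show ?thesis by (simp add: Sm c)
    qed
    have C: "(\<Sum>k=1..?k. (c k (x(?k := e)))\<^sup>2) = (\<Sum>k=1..m. (c k x)\<^sup>2) + (c ?k x)\<^sup>2" for x e
    proof -
      have "(\<Sum>k=1..?k. (c k (x(?k := e)))\<^sup>2) = (\<Sum>k=1..?k. (c k x)\<^sup>2)"
        by (intro sum.cong) (auto simp: c)
      then show ?thesis by simp
    qed
    have z2': "z ?k * (z ?k * t) = t" for t :: real
      using z2 by (simp add: mult.assoc[symmetric])
    have "(\<Sum>x\<in>cube n. noise_weight \<rho> ?k x z * S ?k x)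
        = (\<Sum>x\<in>cube n. noise_weight \<rho> m x z * S m x)"
      by (subst sum_cube_coordinate[OF k], intro sum.cong refl)
        (simp only: w S, simp add: field_simps z2 z2' power2_eq_square)
    moreover have "(\<Sum>x\<in>cube n. noise_weight \<rho> ?k x z * (S ?k x)\<^sup>2)
        = (\<Sum>x\<in>cube n. noise_weight \<rho> m x z * (S m x)\<^sup>2)
          + (\<Sum>x\<in>cube n. noise_weight \<rho> m x z * ((1 - \<rho>\<^sup>2) * (c ?k x)\<^sup>2))"
      by (subst sum_cube_coordinate[OF k], subst sum.distrib[symmetric], intro sum.cong refl)
        (simp only: w S, simp add: field_simps z2 z2' power2_eq_square)
    moreover have "(\<Sum>x\<in>cube n. noise_weight \<rho> ?k x z * ((1 - \<rho>\<^sup>2) * (\<Sum>k=1..?k. (c k x)\<^sup>2)))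
        = (\<Sum>x\<in>cube n. noise_weight \<rho> m x z * ((1 - \<rho>\<^sup>2) * (\<Sum>k=1..m. (c k x)\<^sup>2)))
          + (\<Sum>x\<in>cube n. noise_weight \<rho> m x z * ((1 - \<rho>\<^sup>2) * (c ?k x)\<^sup>2))"
      by (subst sum_cube_coordinate[OF k], subst sum.distrib[symmetric], intro sum.cong refl)
        (simp only: w C, simp add: field_simps)
    moreover have "(\<Sum>x\<in>cube n. noise_weight \<rho> ?k x z) = (\<Sum>x\<in>cube n. noise_weight \<rho> m x z)"
      by (subst sum_cube_coordinate[OF k], intro sum.cong refl)
        (simp only: w, simp add: field_simps)
    ultimately show ?case using Suc by simp
  qed
  then show "(\<Sum>x\<in>cube n. noise_weight \<rho> m x z * S m x) = 0"
    and "(\<Sum>x\<in>cube n. noise_weight \<rho> m x z * (S m x)\<^sup>2)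
       = (1 - \<rho>\<^sup>2) * (\<Sum>x\<in>cube n. noise_weight \<rho> m x z * (\<Sum>k=1..m. (c k x)\<^sup>2))"
    and "(\<Sum>x\<in>cube n. noise_weight \<rho> m x z) = 2 ^ n"
    by (auto simp: sum_distrib_left mult_ac)
qed

section \<open>Entropy of a biased sign\<close>

text \<open>The right-hand side is twice the entropy of a sign with mean \<open>t\<close> relative
  to a fair one. The difference of the two sides vanishes at 0 together with its derivative, and its
  second derivative is \<open>2 * y\<^sup>2 / ((1 + y) * (1 - y))\<close>. Symmetry covers
  \<open>t < 0\<close>.\<close>

lemma two_point_entropy_ge:
  fixes t :: real
  assumes "\<bar>t\<bar> < 1"
  shows "t\<^sup>2 \<le> (1 + t) * ln (1 + t) + (1 - t) * ln (1 - t)"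
proof -
  have *: "t\<^sup>2 \<le> (1 + t) * ln (1 + t) + (1 - t) * ln (1 - t)" if "0 \<le> t" "t < 1" for t :: real
  proof -
    have d: "2 * x \<le> ln (1 + x) - ln (1 - x)" if "0 \<le> x" "x < 1" for x :: real
    proof -
      have "ln (1 + 0) - ln (1 - 0) - 2 * 0 \<le> ln (1 + x) - ln (1 - x) - 2 * x"
      proof (rule DERIV_nonneg_imp_nondecreasing[OF \<open>0 \<le> x\<close>])
        fix y assume y: "0 \<le> y" "y \<le> x"
        have "((\<lambda>y. ln (1 + y) - ln (1 - y) - 2 * y) has_real_derivative
            1 / (1 + y) + 1 / (1 - y) - 2) (at y)"
          using y that by (auto intro!: derivative_eq_intros)
        moreover have "1 / (1 + y) + 1 / (1 - y) - 2 = 2 * y\<^sup>2 / ((1 + y) * (1 - y))"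
        proof -
          have "1 / a + 1 / b - 2 = (a + b - 2 * (a * b)) / (a * b)" if "a \<noteq> 0" "b \<noteq> 0" for a b :: real
            using that by (simp add: field_simps)
          from this[of "1 + y" "1 - y"] show ?thesis
            using y that by (simp add: power2_eq_square algebra_simps)
        qed
        moreover have "0 \<le> 2 * y\<^sup>2 / ((1 + y) * (1 - y))"
          using y that by simp
        ultimately show "\<exists>d. ((\<lambda>y. ln (1 + y) - ln (1 - y) - 2 * y) has_real_derivative d) (at y)
            \<and> 0 \<le> d" by metis
      qed
      then show ?thesis by simp
    qed
    have "(1 + 0) * ln (1 + 0) + (1 - 0) * ln (1 - 0) - 0\<^sup>2
        \<le> (1 + t) * ln (1 + t) + (1 - t) * ln (1 - t) - t\<^sup>2"
    proof (rule DERIV_nonneg_imp_nondecreasing[OF \<open>0 \<le> t\<close>])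
      fix y assume y: "0 \<le> y" "y \<le> t"
      have "((\<lambda>y. (1 + y) * ln (1 + y) + (1 - y) * ln (1 - y) - y\<^sup>2) has_real_derivative
          ln (1 + y) - ln (1 - y) - 2 * y) (at y)"
        using y that by (auto intro!: derivative_eq_intros)
      then show "\<exists>d. ((\<lambda>y. (1 + y) * ln (1 + y) + (1 - y) * ln (1 - y) - y\<^sup>2) has_real_derivative d)
          (at y) \<and> 0 \<le> d" using d[of y] y that by force
    qed
    then show ?thesis by simp
  qed
  show ?thesis
    using *[of t] *[of "- t"] assms by (cases "0 \<le> t") (auto simp: add.commute)
qed

section \<open>The density martingale and its stopping at level \<eta>\<close>

locale noise_level =
  fixes n :: nat and \<rho> \<eta> :: real and f :: "(nat \<Rightarrow> real) \<Rightarrow> real"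
  assumes rho_pos: "0 < \<rho>" and rho_less: "\<rho> < 1" and eta: "1 < \<eta>"
    and f_nonneg: "\<And>z. z \<in> cube n \<Longrightarrow> 0 \<le> f z"
    and sum_f: "(\<Sum>z\<in>cube n. f z) = 2 ^ n"
begin

text \<open>
  \<open>avg k x\<close> is the mean of \<open>noise_op n \<rho> f\<close> over the coordinates after \<open>k\<close>, and
  \<open>drift k x\<close> is the mean of the \<open>k\<close>-th coordinate, given the earlier ones, under the
  measure with density \<open>noise_op n \<rho> f\<close>.
\<close>

definition avg :: "nat \<Rightarrow> (nat \<Rightarrow> real) \<Rightarrow> real" where
  "avg k x = (\<Sum>z\<in>cube n. f z * noise_weight \<rho> k x z) / 2 ^ n"

definition drift :: "nat \<Rightarrow> (nat \<Rightarrow> real) \<Rightarrow> real" where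
  "drift k x = (\<Sum>z\<in>cube n. f z * (\<rho> * z k) * noise_weight \<rho> (k - 1) x z) / 2 ^ n / avg (k - 1) x"

text \<open>The strict bound on \<open>j\<close> makes the stopping predictable, while the step that
  crosses \<eta> is still kept.\<close>

definition active :: "nat \<Rightarrow> (nat \<Rightarrow> real) \<Rightarrow> bool" where
  "active k x \<longleftrightarrow> (\<forall>j<k. avg j x \<le> \<eta>)"

definition ctrl :: "nat \<Rightarrow> (nat \<Rightarrow> real) \<Rightarrow> real" where
  "ctrl k x = (if active k x then drift k x else 0)"

text \<open>On the cube and before stopping, this is the logarithm of
  \<open>avg k x / avg (k - 1) x\<close> for \<open>1 \<le> k \<le> n\<close>, so the sums
  telescope.\<close>

definition incr :: "nat \<Rightarrow> (nat \<Rightarrow> real) \<Rightarrow> real" where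
  "incr k x = (if active k x then ln (1 + drift k x * x k) else 0)"

definition above :: "(nat \<Rightarrow> real) \<Rightarrow> real" where
  "above x = (if \<eta> < avg n x then 1 else 0)"

lemma noise_op_eq_avg: "noise_op n \<rho> f x = avg n x"
  by (simp add: noise_op_def avg_def noise_weight_def)

lemma avg_upd: "j < k \<Longrightarrow> avg j (x(k := e)) = avg j x"
  by (simp add: avg_def noise_weight_upd_above)

lemma drift_upd: "1 \<le> j \<Longrightarrow> j \<le> k \<Longrightarrow> drift j (x(k := e)) = drift j x"
  by (simp add: drift_def avg_upd noise_weight_upd_above)

lemma active_upd: "j \<le> k \<Longrightarrow> active j (x(k := e)) = active j x"
  unfolding active_def by (auto simp: avg_upd)

lemma ctrl_upd: "1 \<le> j \<Longrightarrow> j \<le> k \<Longrightarrow> ctrl j (x(k := e)) = ctrl j x"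
  by (simp add: ctrl_def active_upd drift_upd)

lemma avg_0: "avg 0 x = 1"
  by (simp add: avg_def sum_f)

lemma avg_pos:
  assumes "x \<in> cube n" "k \<le> n"
  shows "0 < avg k x"
proof -
  obtain z where z: "z \<in> cube n" "f z \<noteq> 0"
    using sum_f by (metis power_not_zero sum.neutral zero_neq_numeral)
  have w: "0 < noise_weight \<rho> k x z" if "z \<in> cube n" for z
    using noise_weight_pos[OF rho_pos rho_less assms(1) that assms(2)] .
  have "0 < f z" using f_nonneg[OF z(1)] z(2) by simp
  then have "0 < f z * noise_weight \<rho> k x z" using w[OF z(1)] by simp
  then have "0 < (\<Sum>z\<in>cube n. f z * noise_weight \<rho> k x z)"
    by (rule sum_pos2[OF finite_cube z(1)]) (simp add: f_nonneg less_imp_le[OF w])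
  then show ?thesis by (simp add: avg_def)
qed

text \<open>The kernel is affine in coordinate \<open>Suc k\<close>. Averaging over
  \<open>e = 1\<close> and \<open>e = - 1\<close> shows that \<open>avg\<close> is a
  martingale.\<close>

lemma avg_Suc:
  assumes "x \<in> cube n" "Suc k \<le> n"
  shows "avg (Suc k) (x(Suc k := e)) = avg k x * (1 + drift (Suc k) x * e)"
proof -
  have "avg (Suc k) (x(Suc k := e))
      = avg k x + e * ((\<Sum>z\<in>cube n. f z * (\<rho> * z (Suc k)) * noise_weight \<rho> k x z) / 2 ^ n)"
    by (simp add: avg_def noise_weight_Suc noise_weight_upd_above sum_divide_distrib sum_distrib_left
        sum.distrib[symmetric] field_simps)
  then show ?thesis
    using avg_pos[of x k] assms by (simp add: drift_def distrib_left)
qed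

lemma avg_Suc':
  assumes "x \<in> cube n" "Suc k \<le> n"
  shows "avg (Suc k) x = avg k x * (1 + drift (Suc k) x * x (Suc k))"
  using avg_Suc[OF assms, of "x (Suc k)"] by (simp only: fun_upd_triv)

text \<open>Every factor of the kernel is at most 2. This limits the overshoot at the crossing and
  is the source of \<open>ln (2 * \<eta>)\<close>.\<close>

lemma avg_Suc_le:
  assumes "x \<in> cube n" "Suc k \<le> n"
  shows "avg (Suc k) x \<le> 2 * avg k x"
proof -
  have "(\<Sum>z\<in>cube n. f z * noise_weight \<rho> (Suc k) x z) \<le> (\<Sum>z\<in>cube n. 2 * (f z * noise_weight \<rho> k x z))"
  proof (rule sum_mono)
    fix z assume z: "z \<in> cube n"
    have "noise_weight \<rho> (Suc k) x z \<le> noise_weight \<rho> k x z * 2"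
      unfolding noise_weight_Suc using assms z rho_pos rho_less
      by (intro mult_left_mono noise_factor_bounds(2) less_imp_le[OF noise_weight_pos]) auto
    then show "f z * noise_weight \<rho> (Suc k) x z \<le> 2 * (f z * noise_weight \<rho> k x z)"
      using mult_left_mono[OF _ f_nonneg[OF z]] by fastforce
  qed
  then show ?thesis
    by (simp add: avg_def sum_distrib_left[symmetric] divide_right_mono)
qed

text \<open>Both ends of an edge in direction \<open>Suc k\<close> have positive
  \<open>avg (Suc k)\<close>.\<close>

lemma drift_abs_less:
  assumes "x \<in> cube n" "Suc k \<le> n"
  shows "\<bar>drift (Suc k) x\<bar> < 1"
proof -
  have "0 < 1 + drift (Suc k) x * e" if "e \<in> {-1, 1}" for e
  proof -
    have "0 < avg (Suc k) (x(Suc k := e))"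
      using assms that by (intro avg_pos cube_fun_upd) auto
    then show ?thesis
      using avg_Suc[OF assms] avg_pos[of x k] assms by (simp add: zero_less_mult_iff)
  qed
  from this[of 1] this[of "-1"] show ?thesis by (simp add: abs_less_iff)
qed

lemma sum_avg:
  assumes "m \<le> n"
  shows "(\<Sum>x\<in>cube n. avg m x) = 2 ^ n"
proof -
  have "(\<Sum>x\<in>cube n. avg m x) = (\<Sum>z\<in>cube n. f z * (\<Sum>x\<in>cube n. noise_weight \<rho> m x z)) / 2 ^ n"
    unfolding avg_def sum_divide_distrib[symmetric] sum_distrib_left by (subst sum.swap) simp
  also have "\<dots> = 2 ^ n"
    using sum_noise_weight_martingale(3)[OF _ assms, where c = "\<lambda>_ _. 0"]
    by (simp add: sum_distrib_right[symmetric] sum_f)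
  finally show ?thesis .
qed

section \<open>Logarithmic increments and the entropy bound\<close>

text \<open>Telescoping: once the level is crossed, the sum stays frozen at the logarithm of
  \<open>avg\<close> at the first crossing, and one step at most doubles \<open>avg\<close>. Note
  that \<open>active (Suc m)\<close> covers the times up to and including \<open>m\<close>.\<close>

lemma sum_incr:
  assumes "x \<in> cube n" "m \<le> n"
  shows "(if active (Suc m) x then (\<Sum>k=1..m. incr k x) = ln (avg m x)
           else ln \<eta> < (\<Sum>k=1..m. incr k x)) \<and> (\<Sum>k=1..m. incr k x) \<le> ln (2 * \<eta>)"
  using assms(2)
proof (induction m)
  case 0
  then show ?case using eta by (simp add: active_def avg_0)
next
  case (Suc m)
  have pos: "0 < avg m x" "0 < avg (Suc m) x"
    using avg_pos assms(1) Suc.prems by auto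
  have act: "active (Suc (Suc m)) x \<longleftrightarrow> active (Suc m) x \<and> avg (Suc m) x \<le> \<eta>"
    unfolding active_def by (auto simp: less_Suc_eq)
  show ?case
  proof (cases "active (Suc m) x")
    case False
    then show ?thesis using Suc act by (simp add: incr_def)
  next
    case True
    have "1 + drift (Suc m) x * x (Suc m) = avg (Suc m) x / avg m x"
      using avg_Suc'[OF assms(1) Suc.prems] pos by simp
    then have S: "(\<Sum>k=1..Suc m. incr k x) = ln (avg (Suc m) x)"
      using True Suc pos by (simp add: incr_def ln_div)
    have "avg m x \<le> \<eta>" using True by (simp add: active_def)
    then have "avg (Suc m) x \<le> 2 * \<eta>"
      using avg_Suc_le[OF assms(1) Suc.prems] by linarith
    then show ?thesis
      using S act True pos eta by (auto simp: ln_less_cancel_iff)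
  qed
qed

lemma ln_le_sum_ctrl:
  assumes "x \<in> cube n" "\<eta> < avg n x"
  shows "ln \<eta> \<le> (\<Sum>k=1..n. ctrl k x * x k)"
proof -
  \<comment> \<open>The index \<open>Suc n\<close> includes time \<open>n\<close>, where the level
    is exceeded.\<close>
  have "\<not> active (Suc n) x" using assms(2) by (auto simp: active_def)
  then have "ln \<eta> < (\<Sum>k=1..n. incr k x)"
    using sum_incr[OF assms(1), of n] by simp
  also have "\<dots> \<le> (\<Sum>k=1..n. ctrl k x * x k)"
  proof (rule sum_mono)
    fix k assume k: "k \<in> {1..n}"
    then obtain j where j: "k = Suc j" by (cases k) auto
    have "\<bar>drift k x * x k\<bar> < 1"
      using drift_abs_less[of x j] assms(1) k j cube_cases[OF assms(1) k] by auto
    then show "incr k x \<le> ctrl k x * x k"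
      by (auto simp: incr_def ctrl_def intro!: ln_add_one_self_le_self2)
  qed
  finally show ?thesis by simp
qed

text \<open>A stopped chain rule for entropy. Under the density \<open>avg n\<close>, the
  conditional mean of \<open>2 * incr k\<close> given the earlier coordinates is the right-hand side
  of \<open>two_point_entropy_ge\<close> at \<open>drift k\<close> while active, and 0 afterwards;
  it dominates the square of \<open>ctrl k\<close>.\<close>

lemma sum_ctrl_sq_le:
  "(\<Sum>x\<in>cube n. avg n x * (\<Sum>k=1..n. (ctrl k x)\<^sup>2)) \<le> 2 ^ n * (2 * ln (2 * \<eta>))"
proof -
  have "(\<Sum>x\<in>cube n. avg m x * (\<Sum>k=1..m. (ctrl k x)\<^sup>2))
      \<le> (\<Sum>x\<in>cube n. avg m x * (2 * (\<Sum>k=1..m. incr k x)))" if "m \<le> n" for m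
    using that
  proof (induction m)
    case 0
    then show ?case by simp
  next
    case (Suc m)
    let ?k = "Suc m"
    have k: "?k \<in> {1..n}" using Suc.prems by simp
    have C: "(\<Sum>k=1..?k. (ctrl k (x(?k := e)))\<^sup>2) = (\<Sum>k=1..m. (ctrl k x)\<^sup>2) + (ctrl ?k x)\<^sup>2" for x e
    proof -
      have "(\<Sum>k=1..?k. (ctrl k (x(?k := e)))\<^sup>2) = (\<Sum>k=1..?k. (ctrl k x)\<^sup>2)"
        by (intro sum.cong) (auto simp: ctrl_upd)
      then show ?thesis by simp
    qed
    have I: "(\<Sum>k=1..?k. incr k (x(?k := e)))
        = (\<Sum>k=1..m. incr k x) + (if active ?k x then ln (1 + drift ?k x * e) else 0)" for x e
    proof -
      have "(\<Sum>k=1..m. incr k (x(?k := e))) = (\<Sum>k=1..m. incr k x)"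
        by (intro sum.cong) (auto simp: incr_def active_upd drift_upd)
      then show ?thesis by (simp add: incr_def active_upd drift_upd)
    qed
    have "(\<Sum>x\<in>cube n. avg ?k x * (\<Sum>k=1..?k. (ctrl k x)\<^sup>2))
        = (\<Sum>x\<in>cube n. avg m x * (\<Sum>k=1..m. (ctrl k x)\<^sup>2)) + (\<Sum>x\<in>cube n. avg m x * (ctrl ?k x)\<^sup>2)"
      unfolding sum.distrib[symmetric]
      by (subst sum_cube_coordinate[OF k], intro sum.cong refl)
        (use Suc.prems in \<open>simp only: C avg_Suc, simp add: field_simps\<close>)
    also have "\<dots> \<le> (\<Sum>x\<in>cube n. avg m x * (2 * (\<Sum>k=1..m. incr k x)))
        + (\<Sum>x\<in>cube n. avg m x * (if active ?k x then (1 + drift ?k x) * ln (1 + drift ?k x)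
            + (1 - drift ?k x) * ln (1 - drift ?k x) else 0))"
    proof (intro add_mono[OF Suc.IH] sum_mono mult_left_mono)
      fix x assume x: "x \<in> cube n"
      show "0 \<le> avg m x" using avg_pos[OF x, of m] Suc.prems by simp
      show "(ctrl ?k x)\<^sup>2 \<le> (if active ?k x then (1 + drift ?k x) * ln (1 + drift ?k x)
          + (1 - drift ?k x) * ln (1 - drift ?k x) else 0)"
        using two_point_entropy_ge[OF drift_abs_less[OF x Suc.prems]] by (simp add: ctrl_def)
    qed (use Suc.prems in simp)
    also have "\<dots> = (\<Sum>x\<in>cube n. avg ?k x * (2 * (\<Sum>k=1..?k. incr k x)))"
      unfolding sum.distrib[symmetric]
      by (subst (2) sum_cube_coordinate[OF k], intro sum.cong refl)
        (use Suc.prems in \<open>simp only: I avg_Suc, simp add: field_simps\<close>)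
    finally show ?case .
  qed
  from this[of n] have "(\<Sum>x\<in>cube n. avg n x * (\<Sum>k=1..n. (ctrl k x)\<^sup>2))
      \<le> (\<Sum>x\<in>cube n. avg n x * (2 * (\<Sum>k=1..n. incr k x)))" by simp
  also have "\<dots> \<le> (\<Sum>x\<in>cube n. avg n x * (2 * ln (2 * \<eta>)))"
    using sum_incr avg_pos by (intro sum_mono mult_left_mono) (auto simp: less_imp_le)
  also have "\<dots> = 2 ^ n * (2 * ln (2 * \<eta>))"
    by (simp only: sum_distrib_right[symmetric] sum_avg[OF order_refl])
  finally show ?thesis .
qed

section \<open>A martingale with sign-tilted coefficients\<close>

text \<open>
  \<open>ctrl 0\<close> is junk (it reads coordinate \<open>0\<close>); excluding it makes \<open>coeff\<close> predictable at every index.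
\<close>

definition coeff :: "(nat \<Rightarrow> real) \<Rightarrow> nat \<Rightarrow> (nat \<Rightarrow> real) \<Rightarrow> real" where
  "coeff z k x = (if k = 0 then 0 else ctrl k x * (1 + \<rho> * sgn (ctrl k x) * z k))"

definition mart :: "(nat \<Rightarrow> real) \<Rightarrow> (nat \<Rightarrow> real) \<Rightarrow> real" where
  "mart z x = (\<Sum>k=1..n. coeff z k x * (x k - \<rho> * z k))"

lemma coeff_upd: "j \<le> k \<Longrightarrow> coeff z j (x(k := e)) = coeff z j x"
  by (simp add: coeff_def ctrl_upd)

lemma coeff_sq_le:
  assumes "z \<in> cube n" "k \<in> {1..n}"
  shows "(coeff z k x)\<^sup>2 \<le> (1 + \<rho>)\<^sup>2 * (ctrl k x)\<^sup>2"
proof -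
  have "\<bar>1 + \<rho> * sgn (ctrl k x) * z k\<bar> \<le> 1 + \<rho>"
    using cube_cases[OF assms] rho_pos rho_less by (auto simp: sgn_real_def)
  then have "(1 + \<rho> * sgn (ctrl k x) * z k)\<^sup>2 \<le> (1 + \<rho>)\<^sup>2"
    using rho_pos by (simp add: abs_le_square_iff[symmetric])
  moreover have "(coeff z k x)\<^sup>2 = (1 + \<rho> * sgn (ctrl k x) * z k)\<^sup>2 * (ctrl k x)\<^sup>2"
    using assms(2) by (simp add: coeff_def power_mult_distrib)
  ultimately show ?thesis by (simp only: mult_right_mono zero_le_power2)
qed

lemma sum_mart_sq_le:
  "(\<Sum>z\<in>cube n. f z * (\<Sum>x\<in>cube n. noise_weight \<rho> n x z * (mart z x)\<^sup>2))
     \<le> (1 - \<rho>\<^sup>2) * (1 + \<rho>)\<^sup>2 * (2 ^ n * (2 ^ n * (2 * ln (2 * \<eta>))))"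
proof -
  have r2: "0 \<le> 1 - \<rho>\<^sup>2" using rho_pos rho_less by (simp add: power_le_one)
  have "(\<Sum>z\<in>cube n. f z * (\<Sum>x\<in>cube n. noise_weight \<rho> n x z * (mart z x)\<^sup>2))
      = (\<Sum>z\<in>cube n. f z * ((1 - \<rho>\<^sup>2) * (\<Sum>x\<in>cube n. noise_weight \<rho> n x z * (\<Sum>k=1..n. (coeff z k x)\<^sup>2))))"
    unfolding mart_def
    by (intro sum.cong refl arg_cong2[where f = times] sum_noise_weight_martingale(2))
      (auto simp: coeff_upd)
  also have "\<dots> \<le> (\<Sum>z\<in>cube n. f z * ((1 - \<rho>\<^sup>2) *
      (\<Sum>x\<in>cube n. noise_weight \<rho> n x z * (\<Sum>k=1..n. (1 + \<rho>)\<^sup>2 * (ctrl k x)\<^sup>2))))"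
    using r2 rho_pos rho_less
    by (intro sum_mono mult_left_mono coeff_sq_le f_nonneg less_imp_le[OF noise_weight_pos]) auto
  also have "\<dots> = (1 - \<rho>\<^sup>2) * (1 + \<rho>)\<^sup>2 *
      (\<Sum>z\<in>cube n. \<Sum>x\<in>cube n. f z * noise_weight \<rho> n x z * (\<Sum>k=1..n. (ctrl k x)\<^sup>2))"
    by (simp add: sum_distrib_left mult_ac)
  \<comment> \<open>Summing out \<open>z\<close> against \<open>f\<close> turns the kernel into
    \<open>2 ^ n * avg n x\<close>.\<close>
  also have "(\<Sum>z\<in>cube n. \<Sum>x\<in>cube n. f z * noise_weight \<rho> n x z * (\<Sum>k=1..n. (ctrl k x)\<^sup>2))
      = 2 ^ n * (\<Sum>x\<in>cube n. avg n x * (\<Sum>k=1..n. (ctrl k x)\<^sup>2))"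
    by (subst sum.swap) (simp add: avg_def sum_distrib_left[symmetric] sum_distrib_right[symmetric]
        sum_divide_distrib[symmetric])
  also have "(1 - \<rho>\<^sup>2) * (1 + \<rho>)\<^sup>2 * (2 ^ n * (\<Sum>x\<in>cube n. avg n x * (\<Sum>k=1..n. (ctrl k x)\<^sup>2)))
      \<le> (1 - \<rho>\<^sup>2) * (1 + \<rho>)\<^sup>2 * (2 ^ n * (2 ^ n * (2 * ln (2 * \<eta>))))"
    using r2 by (intro mult_left_mono sum_ctrl_sq_le) auto
  finally show ?thesis .
qed

section \<open>Edges leaving the level set\<close>

text \<open>For signs \<open>a\<close> and \<open>b\<close>, \<open>(1 + \<rho> * a * b) * (a -
  \<rho> * b) = (1 - \<rho>\<^sup>2) * a\<close>, which erases \<open>z k\<close> from the kernel;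
  the factor in \<open>coeff\<close> restores it with \<open>sgn (ctrl k x)\<close> in place of
  \<open>x k\<close>. If \<open>ctrl k x = 0\<close>, the updated point is off the cube, but both
  sides vanish.\<close>

lemma noise_weight_tilt:
  assumes "x \<in> cube n" "z \<in> cube n" "k \<in> {1..n}"
  shows "noise_weight \<rho> n x z * (coeff z k x * (x k - \<rho> * z k))
    = (1 - \<rho>\<^sup>2) * (ctrl k x * x k) * noise_weight \<rho> n (x(k := sgn (ctrl k x))) z"
proof -
  let ?R = "\<Prod>i\<in>{1..n} - {k}. 1 + \<rho> * x i * z i"
  have R: "(\<Prod>i\<in>{1..n} - {k}. 1 + \<rho> * (x(k := e)) i * z i) = ?R" for e
    by (intro prod.cong) auto
  have "(1 + \<rho> * x k * z k) * (x k - \<rho> * z k) = (1 - \<rho>\<^sup>2) * x k"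
    using cube_cases[OF assms(1,3)] cube_cases[OF assms(2,3)]
    by (auto simp: power2_eq_square algebra_simps)
  then have "?R * coeff z k x * ((1 + \<rho> * x k * z k) * (x k - \<rho> * z k))
      = ?R * coeff z k x * ((1 - \<rho>\<^sup>2) * x k)" by simp
  moreover have "noise_weight \<rho> n (x(k := sgn (ctrl k x))) z = (1 + \<rho> * sgn (ctrl k x) * z k) * ?R"
    by (subst noise_weight_remove[OF assms(3)]) (simp add: R)
  moreover have "coeff z k x = ctrl k x * (1 + \<rho> * sgn (ctrl k x) * z k)"
    using assms(3) by (simp add: coeff_def)
  ultimately show ?thesis
    by (simp only: noise_weight_remove[OF assms(3), of \<rho> x z] mult_ac)
qed

text \<open>
  The sign in \<open>coeff\<close> selects the endpoint of an edge at which the density is evaluated. On an edge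
  leaving \<open>{avg n > \<eta>}\<close> it makes this density at least \<open>\<eta>\<close> if the edge contributes positively, and
  at most \<open>\<eta>\<close> if it contributes negatively.
\<close>

lemma sum_above_ctrl_ge:
  assumes k: "k \<in> {1..n}"
  shows "\<eta> * (\<Sum>x\<in>cube n. above x * (ctrl k x * x k))
    \<le> (\<Sum>x\<in>cube n. above x * (ctrl k x * x k) * avg n (x(k := sgn (ctrl k x))))"
proof -
  let ?h = "\<lambda>x. above x * (ctrl k x * x k) * (avg n (x(k := sgn (ctrl k x))) - \<eta>)"
  have "0 \<le> ?h (x(k := 1)) + ?h (x(k := - 1))" for x
  proof -
    have u: "ctrl k (x(k := e)) = ctrl k x" for e
      using k by (simp add: ctrl_upd)
    consider "ctrl k x = 0" | "ctrl k x > 0" | "ctrl k x < 0" by linarith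
    then show ?thesis
    proof cases
      case 1
      then show ?thesis by (simp add: u)
    next
      case 2
      have "0 \<le> (above (x(k := 1)) - above (x(k := - 1))) * (avg n (x(k := 1)) - \<eta>)"
        by (simp add: above_def)
      then have "0 \<le> ctrl k x * ((above (x(k := 1)) - above (x(k := - 1))) * (avg n (x(k := 1)) - \<eta>))"
        by (rule mult_nonneg_nonneg[OF less_imp_le[OF 2]])
      then show ?thesis using 2 by (simp add: u algebra_simps)
    next
      case 3
      have "0 \<le> (above (x(k := - 1)) - above (x(k := 1))) * (avg n (x(k := - 1)) - \<eta>)"
        by (simp add: above_def)
      then have "0 \<le> - ctrl k x * ((above (x(k := - 1)) - above (x(k := 1))) * (avg n (x(k := - 1)) - \<eta>))"
        by (rule mult_nonneg_nonneg[rotated]) (use 3 in simp)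
      then show ?thesis using 3 by (simp add: u algebra_simps)
    qed
  qed
  then have "0 \<le> (\<Sum>x\<in>cube n. ?h x)"
    by (subst sum_cube_coordinate[OF k]) (intro sum_nonneg divide_nonneg_nonneg, auto)
  then show ?thesis
    by (simp add: right_diff_distrib sum_subtractf sum_distrib_left mult_ac)
qed

text \<open>By \<open>noise_weight_tilt\<close>, summing out \<open>z\<close> leaves
  \<open>avg n\<close> at the endpoint picked by the sign of \<open>ctrl\<close>. Then
  \<open>sum_above_ctrl_ge\<close> replaces it by \<eta>, one direction at a time.\<close>

lemma sum_above_mart_ge:
  "(1 - \<rho>\<^sup>2) * 2 ^ n * \<eta> * (\<Sum>x\<in>cube n. above x * (\<Sum>k=1..n. ctrl k x * x k))
    \<le> (\<Sum>z\<in>cube n. \<Sum>x\<in>cube n. f z * noise_weight \<rho> n x z * (above x * mart z x))"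
proof -
  have r2: "0 \<le> 1 - \<rho>\<^sup>2" using rho_pos rho_less by (simp add: power_le_one)
  have "(\<Sum>z\<in>cube n. \<Sum>x\<in>cube n. f z * noise_weight \<rho> n x z * (above x * mart z x))
      = (\<Sum>z\<in>cube n. \<Sum>x\<in>cube n. \<Sum>k=1..n.
          f z * above x * (noise_weight \<rho> n x z * (coeff z k x * (x k - \<rho> * z k))))"
    by (simp add: mart_def sum_distrib_left mult_ac)
  also have "\<dots> = (\<Sum>z\<in>cube n. \<Sum>x\<in>cube n. \<Sum>k=1..n. f z * above x *
      ((1 - \<rho>\<^sup>2) * (ctrl k x * x k) * noise_weight \<rho> n (x(k := sgn (ctrl k x))) z))"
    by (intro sum.cong refl) (simp add: noise_weight_tilt)
  also have "\<dots> = (\<Sum>x\<in>cube n. \<Sum>k=1..n. \<Sum>z\<in>cube n. f z * above x *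
      ((1 - \<rho>\<^sup>2) * (ctrl k x * x k) * noise_weight \<rho> n (x(k := sgn (ctrl k x))) z))"
    by (subst sum.swap) (intro sum.cong refl, subst sum.swap, rule refl)
  also have "\<dots> = (\<Sum>x\<in>cube n. \<Sum>k=1..n. (1 - \<rho>\<^sup>2) * 2 ^ n *
      (above x * (ctrl k x * x k) * avg n (x(k := sgn (ctrl k x)))))"
    by (intro sum.cong refl) (simp add: avg_def sum_distrib_left sum_divide_distrib mult_ac)
  also have "\<dots> = (1 - \<rho>\<^sup>2) * 2 ^ n * (\<Sum>k=1..n. \<Sum>x\<in>cube n.
      above x * (ctrl k x * x k) * avg n (x(k := sgn (ctrl k x))))"
    by (subst sum.swap) (simp add: sum_distrib_left)
  also have "\<dots> \<ge> (1 - \<rho>\<^sup>2) * 2 ^ n * (\<Sum>k=1..n. \<eta> * (\<Sum>x\<in>cube n. above x * (ctrl k x * x k)))"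
    using r2 by (intro mult_left_mono sum_mono sum_above_ctrl_ge) auto
  also have "(\<Sum>k=1..n. \<eta> * (\<Sum>x\<in>cube n. above x * (ctrl k x * x k)))
      = \<eta> * (\<Sum>x\<in>cube n. above x * (\<Sum>k=1..n. ctrl k x * x k))"
    unfolding sum_distrib_left by (subst sum.swap) simp
  finally show ?thesis by (simp add: mult_ac)
qed

section \<open>Markov's inequality, Cauchy-Schwarz and the constants\<close>

lemma sum_above_le: "\<eta> * (\<Sum>x\<in>cube n. above x) \<le> 2 ^ n"
proof -
  have "\<eta> * (\<Sum>x\<in>cube n. above x) \<le> (\<Sum>x\<in>cube n. avg n x)"
    unfolding sum_distrib_left
    by (intro sum_mono) (auto simp: above_def less_imp_le avg_pos)
  then show ?thesis by (simp add: sum_avg)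
qed

lemma sum_above_sq_le:
  "((1 - \<rho>\<^sup>2) * 2 ^ n * \<eta> * (ln \<eta> * (\<Sum>x\<in>cube n. above x)))\<^sup>2
    \<le> 2 ^ n * 2 ^ n / 4 * ((1 - \<rho>\<^sup>2) * (1 + \<rho>)\<^sup>2 * (2 ^ n * (2 ^ n * (2 * ln (2 * \<eta>)))))"
proof -
  have r2: "0 \<le> 1 - \<rho>\<^sup>2" using rho_pos rho_less by (simp add: power_le_one)
  let ?C = "cube n \<times> cube n"
  let ?q = "\<lambda>(z, x). f z * noise_weight \<rho> n x z"
  have q: "0 \<le> ?q p" if "p \<in> ?C" for p
    using that f_nonneg rho_pos rho_less
    by (auto intro!: mult_nonneg_nonneg less_imp_le[OF noise_weight_pos])
  have "ln \<eta> * (\<Sum>x\<in>cube n. above x) \<le> (\<Sum>x\<in>cube n. above x * (\<Sum>k=1..n. ctrl k x * x k))"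
    unfolding sum_distrib_left using ln_le_sum_ctrl
    by (intro sum_mono) (auto simp: above_def)
  then have "(1 - \<rho>\<^sup>2) * 2 ^ n * \<eta> * (ln \<eta> * (\<Sum>x\<in>cube n. above x))
      \<le> (1 - \<rho>\<^sup>2) * 2 ^ n * \<eta> * (\<Sum>x\<in>cube n. above x * (\<Sum>k=1..n. ctrl k x * x k))"
    using r2 eta by (intro mult_left_mono) auto
  also have "\<dots> \<le> (\<Sum>z\<in>cube n. \<Sum>x\<in>cube n. f z * noise_weight \<rho> n x z * (above x * mart z x))"
    by (rule sum_above_mart_ge)
  \<comment> \<open>For each \<open>z\<close> the martingale has kernel mean 0, so the indicator may
    be centred at 1/2. Its modulus is then 1/2 everywhere, whence the factor 1/4 below.\<close>
  also have "\<dots> = (\<Sum>z\<in>cube n. \<Sum>x\<in>cube n. f z * noise_weight \<rho> n x z * ((above x - 1/2) * mart z x))"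
  proof (rule sum.cong[OF refl])
    fix z assume z: "z \<in> cube n"
    have "(\<Sum>x\<in>cube n. noise_weight \<rho> n x z * mart z x) = 0"
      unfolding mart_def
      by (rule sum_noise_weight_martingale(1)[OF z order_refl]) (rule coeff_upd)
    then have "(\<Sum>x\<in>cube n. f z * noise_weight \<rho> n x z * (mart z x / 2)) = 0"
      by (simp add: sum_distrib_left[symmetric] sum_divide_distrib[symmetric] mult.assoc)
    then show "(\<Sum>x\<in>cube n. f z * noise_weight \<rho> n x z * (above x * mart z x))
        = (\<Sum>x\<in>cube n. f z * noise_weight \<rho> n x z * ((above x - 1/2) * mart z x))"
      by (simp add: algebra_simps sum_subtractf)
  qed
  \<comment> \<open>Splitting the weight into two square roots makes the unweighted Cauchy-Schwarz
    inequality give the weighted one.\<close>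
  also have "\<dots> = (\<Sum>p\<in>?C. (sqrt (?q p) * (above (snd p) - 1/2)) * (sqrt (?q p) * mart (fst p) (snd p)))"
    unfolding sum.cartesian_product
  proof (rule sum.cong[OF refl])
    fix p assume "p \<in> ?C"
    then have "sqrt (?q p) * sqrt (?q p) = ?q p" using q by simp
    moreover obtain z x where "p = (z, x)" by (cases p)
    ultimately show "(case p of (z, x) \<Rightarrow> f z * noise_weight \<rho> n x z * ((above x - 1/2) * mart z x))
        = (sqrt (?q p) * (above (snd p) - 1/2)) * (sqrt (?q p) * mart (fst p) (snd p))"
      by (simp only: prod.case fst_conv snd_conv) (metis mult.assoc mult.left_commute)
  qed
  finally have *: "(1 - \<rho>\<^sup>2) * 2 ^ n * \<eta> * (ln \<eta> * (\<Sum>x\<in>cube n. above x)) \<le> \<dots>" .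
  have "0 \<le> (1 - \<rho>\<^sup>2) * 2 ^ n * \<eta> * (ln \<eta> * (\<Sum>x\<in>cube n. above x))"
    using r2 eta by (intro mult_nonneg_nonneg sum_nonneg) (auto simp: above_def)
  with * have "((1 - \<rho>\<^sup>2) * 2 ^ n * \<eta> * (ln \<eta> * (\<Sum>x\<in>cube n. above x)))\<^sup>2
      \<le> (\<Sum>p\<in>?C. (sqrt (?q p) * (above (snd p) - 1/2)) * (sqrt (?q p) * mart (fst p) (snd p)))\<^sup>2"
    by (intro power_mono)
  also have "\<dots> \<le> (\<Sum>p\<in>?C. (sqrt (?q p) * (above (snd p) - 1/2))\<^sup>2)
      * (\<Sum>p\<in>?C. (sqrt (?q p) * mart (fst p) (snd p))\<^sup>2)"
    by (rule Cauchy_Schwarz_ineq_sum)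
  also have "(\<Sum>p\<in>?C. (sqrt (?q p) * (above (snd p) - 1/2))\<^sup>2) = (\<Sum>p\<in>?C. ?q p / 4)"
    using q by (intro sum.cong refl) (auto simp: power_mult_distrib above_def power2_eq_square)
  also have "\<dots> = (\<Sum>z\<in>cube n. f z * (\<Sum>x\<in>cube n. noise_weight \<rho> n x z)) / 4"
    by (simp add: sum.cartesian_product[symmetric] sum_distrib_left sum_divide_distrib[symmetric])
  also have "\<dots> = 2 ^ n * 2 ^ n / 4"
    using sum_noise_weight_martingale(3)[OF _ order_refl, where c = "\<lambda>_ _. 0"]
    by (simp add: sum_distrib_right[symmetric] sum_f)
  also have "(\<Sum>p\<in>?C. (sqrt (?q p) * mart (fst p) (snd p))\<^sup>2)
      = (\<Sum>z\<in>cube n. f z * (\<Sum>x\<in>cube n. noise_weight \<rho> n x z * (mart z x)\<^sup>2))"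
    unfolding sum_distrib_left sum.cartesian_product using q
    by (intro sum.cong refl) (auto simp: power_mult_distrib mult_ac)
  also have "2 ^ n * 2 ^ n / 4 * \<dots>
      \<le> 2 ^ n * 2 ^ n / 4 * ((1 - \<rho>\<^sup>2) * (1 + \<rho>)\<^sup>2 * (2 ^ n * (2 ^ n * (2 * ln (2 * \<eta>)))))"
    by (intro mult_left_mono sum_mart_sq_le) auto
  finally show ?thesis .
qed

lemma sum_above_bound:
  "(\<Sum>x\<in>cube n. above x) / 2 ^ n \<le> sqrt ((1 + \<rho>) / (1 - \<rho>)) * (1 / (\<eta> * sqrt (ln \<eta>)))"
proof -
  let ?a = "(\<Sum>x\<in>cube n. above x) / 2 ^ n"
  let ?s = "ln \<eta>"
  let ?K2 = "(1 + \<rho>) / (1 - \<rho>)"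
  have s: "0 < ?s" using eta by simp
  have a: "0 \<le> ?a" by (intro divide_nonneg_nonneg sum_nonneg) (auto simp: above_def)
  then have "0 \<le> \<eta> * ?a" using eta by (intro mult_nonneg_nonneg) auto
  have K2: "1 \<le> ?K2" using rho_pos rho_less by simp
  have "(\<eta> * ?a)\<^sup>2 * ?s \<le> ?K2"
  proof (cases "?s \<le> 1")
    case True
    have "\<eta> * ?a \<le> 1" using sum_above_le by (simp add: field_simps)
    with \<open>0 \<le> \<eta> * ?a\<close> have "(\<eta> * ?a)\<^sup>2 \<le> 1" by (intro power_le_one)
    then have "(\<eta> * ?a)\<^sup>2 * ?s \<le> 1 * 1" using True s by (intro mult_mono) auto
    then show ?thesis using K2 by simp
  next
    case False
    have r2: "0 < 1 - \<rho>\<^sup>2" using rho_pos rho_less by (simp add: power_less_one_iff)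
    \<comment> \<open>In this case \<open>ln 2 < 1 < ln \<eta>\<close>.\<close>
    have "ln (2 * \<eta>) \<le> 2 * ?s"
      using False eta ln_2_less_1 ln_mult_pos[of 2 \<eta>] by linarith
    have "(2 ^ n) ^ 4 * ((1 - \<rho>\<^sup>2) * ?s) * ((1 - \<rho>\<^sup>2) * ((\<eta> * ?a)\<^sup>2 * ?s))
        = ((1 - \<rho>\<^sup>2) * 2 ^ n * \<eta> * (?s * (\<Sum>x\<in>cube n. above x)))\<^sup>2"
      by (simp add: field_simps power2_eq_square power4_eq_xxxx)
    also have "\<dots> \<le> 2 ^ n * 2 ^ n / 4 * ((1 - \<rho>\<^sup>2) * (1 + \<rho>)\<^sup>2 * (2 ^ n * (2 ^ n * (2 * ln (2 * \<eta>)))))"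
      by (rule sum_above_sq_le)
    also have "\<dots> \<le> 2 ^ n * 2 ^ n / 4 * ((1 - \<rho>\<^sup>2) * (1 + \<rho>)\<^sup>2 * (2 ^ n * (2 ^ n * (2 * (2 * ?s)))))"
      using r2 \<open>ln (2 * \<eta>) \<le> 2 * ?s\<close> by (intro mult_left_mono) auto
    \<comment> \<open>The constants cancel exactly: 1/4 from the centring, 2 from the entropy bound,
      2 from \<open>ln (2 * \<eta>) \<le> 2 * ln \<eta>\<close>.\<close>
    also have "\<dots> = (2 ^ n) ^ 4 * ((1 - \<rho>\<^sup>2) * ?s) * (1 + \<rho>)\<^sup>2"
      by (simp add: power4_eq_xxxx)
    finally have "(1 - \<rho>\<^sup>2) * ((\<eta> * ?a)\<^sup>2 * ?s) \<le> (1 + \<rho>)\<^sup>2"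
      using r2 s by (subst (asm) mult_le_cancel_left_pos) auto
    then have "(1 + \<rho>) * ((1 - \<rho>) * ((\<eta> * ?a)\<^sup>2 * ?s)) \<le> (1 + \<rho>) * (1 + \<rho>)"
      by (simp add: power2_eq_square algebra_simps)
    then have "(1 - \<rho>) * ((\<eta> * ?a)\<^sup>2 * ?s) \<le> 1 + \<rho>"
      using rho_pos by (subst (asm) mult_le_cancel_left_pos) auto
    then show ?thesis using rho_less by (simp add: pos_le_divide_eq mult.commute)
  qed
  then have "sqrt ((\<eta> * ?a)\<^sup>2 * ?s) \<le> sqrt ?K2" by (rule real_sqrt_le_mono)
  then have "\<eta> * ?a * sqrt ?s \<le> sqrt ?K2"
    using \<open>0 \<le> \<eta> * ?a\<close> by (simp only: real_sqrt_mult real_sqrt_abs abs_of_nonneg)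
  then have "?a \<le> sqrt ?K2 / (\<eta> * sqrt ?s)"
    using eta s by (subst pos_le_divide_eq) (auto simp: mult_ac)
  then show ?thesis by simp
qed

end

theorem theorem3p3:
  fixes n :: nat and \<rho> \<eta> :: real and f :: "(nat \<Rightarrow> real) \<Rightarrow> real"
  assumes "n \<ge> 1"
    and "0 < \<rho>" and "\<rho> < 1"
    and "\<And>x. x \<in> cube n \<Longrightarrow> f x \<ge> 0"
    and "measure_pmf.expectation (cube_pmf n) f = 1"
    and "\<eta> > 1"
  shows "measure_pmf.prob (cube_pmf n) {x \<in> cube n. noise_op n \<rho> f x > \<eta>}
           \<le> sqrt ((1 + \<rho>) / (1 - \<rho>)) * (1 / (\<eta> * sqrt (ln \<eta>)))"
proof -
  interpret noise_level n \<rho> \<eta> f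
  proof
    show "(\<Sum>z\<in>cube n. f z) = 2 ^ n"
      using assms(5) finite_cube[of n] cube_nonempty[of n]
      by (simp add: cube_pmf_def integral_pmf_of_set card_cube)
  qed (use assms in auto)
  have "measure_pmf.prob (cube_pmf n) {x \<in> cube n. noise_op n \<rho> f x > \<eta>}
      = card (cube n \<inter> {x \<in> cube n. noise_op n \<rho> f x > \<eta>}) / 2 ^ n"
    by (simp add: cube_pmf_def measure_pmf_of_set finite_cube cube_nonempty card_cube)
  also have "\<dots> = (\<Sum>x\<in>cube n. above x) / 2 ^ n"
    by (simp add: above_def noise_op_eq_avg sum.If_cases finite_cube Int_def)
  also have "\<dots> \<le> sqrt ((1 + \<rho>) / (1 - \<rho>)) * (1 / (\<eta> * sqrt (ln \<eta>)))"
    by (rule sum_above_bound)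
  finally show ?thesis .
qed

end
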